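(* For every complex polynomial $f$ of the indicated degree $D$ the following relations hold. Degree $3$: $\varphi_{3,0,1}-\varphi_{3,0,2}=0$. Degree $4$: $5\varphi_{4,0,1}-6\varphi_{4,0,2}+\varphi_{4,0,3}=0$. Degree $5$: $\varphi_{5,0,1}-3\varphi_{5,0,3}+2\varphi_{5,0,4}=0$; $2\varphi_{5,0,2}-5\varphi_{5,0,3}+3\varphi_{5,0,4}=0$; $3\varphi_{5,0,1}-4\varphi_{5,0,2}+\varphi_{5,0,3}=0$; $5\varphi_{5,0,1}-6\varphi_{5,0,2}+\varphi_{5,0,4}=0$; $\varphi_{5,0,1}-2\varphi_{5,0,2}+2\varphi_{5,0,3}-\varphi_{5,0,4}=0$. (Any three of these five relations are linearly dependent; any two are linearly independent.) Degree $6$: $77\varphi_{6,0,1}-120\varphi_{6,0,2}+60\varphi_{6,0,3}-20\varphi_{6,0,4}+3\varphi_{6,0,5}=0$. Degree $7$: $85\varphi_{7,0,1}-144\varphi_{7,0,2}+90\varphi_{7,0,3}-40\varphi_{7,0,4}+9\varphi_{7,0,5}=0$; $82\varphi_{7,0,1}-135\varphi_{7,0,2}+75\varphi_{7,0,3}-25\varphi_{7,0,4}+3\varphi_{7,0,6}=0$; $77\varphi_{7,0,1}-120\varphi_{7,0,2}+50\varphi_{7,0,3}-15\varphi_{7,0,5}+8\varphi_{7,0,6}=0$; $67\varphi_{7,0,1}-90\varphi_{7,0,2}+50\varphi_{7,0,4}-45\varphi_{7,0,5}+18\varphi_{7,0,6}=0$; $37\varphi_{7,0,1}-150\varphi_{7,0,3}+200\varphi_{7,0,4}-135\varphi_{7,0,5}+48\varphi_{7,0,6}=0$;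 $111\varphi_{7,0,2}-335\varphi_{7,0,3}+385\varphi_{7,0,4}-246\varphi_{7,0,5}+85\varphi_{7,0,6}=0$; $\varphi_{7,0,1}-3\varphi_{7,0,2}+5\varphi_{7,0,3}-5\varphi_{7,0,4}+3\varphi_{7,0,5}-\varphi_{7,0,6}=0$. (Any three of these seven relations are linearly dependent; any two are linearly independent.) Degree $8$: $669\varphi_{8,0,1}-1260\varphi_{8,0,2}+1050\varphi_{8,0,3}-700\varphi_{8,0,4}+315\varphi_{8,0,5}-84\varphi_{8,0,6}+10\varphi_{8,0,7}=0$. Moreover the list is exhaustive: for each $D\in\{2,\dots,8\}$, if $(\alpha_1,\dots,\alpha_{D-1})\in\mathbb{C}^{D-1}$ is such that $\sum_{\rho=1}^{D-1}\alpha_\rho\,\varphi_{D,0,\rho}=0$ for every polynomial $f$ of degree $D$, then $(\alpha_1,\dots,\alpha_{D-1})$ is a linear combination of the coefficient vectors of the relations listed for degree $D$ (in particular it is $0$ when $D=2$).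
   Context: For a polynomial $f:\mathbb{C}\to\mathbb{C}$ of degree $D$ and $0\le\rho\le D-1$, let $\mathcal{R}^{(\rho)}$ be the multiset of the $D-\rho$ complex roots (counted with multiplicity) of the $\rho$-th derivative $f^{(\rho)}$. Define $\varphi_{D,\delta,\rho}=\frac{1}{D-\rho}\sum_{z\in\mathcal{R}^{(\rho)}} f^{(\delta)}(z)$, the mean value of $f^{(\delta)}$ over the roots of $f^{(\rho)}$; thus $\varphi_{D,0,\rho}$ is the mean value of $f$ over the roots of $f^{(\rho)}$. Linear dependence or independence of relations $\sum_\rho\alpha_\rho\varphi_{D,0,\rho}=0$ refers to their coefficient vectors $(\alpha_1,\dots,\alpha_{D-1})$. *)

theory Defs
  imports
    "HOL-Analysis.Analysis"
    "HOL-Library.Function_Algebras"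
    "HOL-Computational_Algebra.Computational_Algebra"
begin

(* Meant for degree f = D and r < D.  The roots of the r-th derivative are counted with
   multiplicity: over the complex numbers proots has exactly D - r elements. *)
definition phi :: "nat \<Rightarrow> nat \<Rightarrow> nat \<Rightarrow> complex poly \<Rightarrow> complex" where
  "phi D d r f =
     (\<Sum>z\<in>#proots ((pderiv ^^ r) f). poly ((pderiv ^^ d) f) z) / of_nat (D - r)"

definition relation :: "nat \<Rightarrow> (nat \<Rightarrow> complex) \<Rightarrow> complex poly \<Rightarrow> bool" where
  "relation D a f \<longleftrightarrow> (\<Sum>r=1..D-1. a r * phi D 0 r f) = 0"

(* A vector (a_1, ..., a_n) is a function on the naturals that vanishes off {1..n}.
   Addition and zero on functions are the pointwise ones of Function_Algebras. *)
definition vecs :: "nat \<Rightarrow> (nat \<Rightarrow> complex) set" where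
  "vecs n = {a. \<forall>i. i \<notin> {1..n} \<longrightarrow> a i = 0}"

definition vec_of :: "complex list \<Rightarrow> nat \<Rightarrow> complex" where
  "vec_of xs i = (if i \<in> {1..length xs} then xs ! (i - 1) else 0)"

definition scale_vec :: "complex \<Rightarrow> (nat \<Rightarrow> complex) \<Rightarrow> nat \<Rightarrow> complex" where
  "scale_vec c v = (\<lambda>i. c * v i)"

interpretation cvec: vector_space scale_vec
  by unfold_locales (auto simp: scale_vec_def fun_eq_iff algebra_simps)

(* Row [a_1, ..., a_(D-1)] stands for a_1 phi_(D,0,1) + ... + a_(D-1) phi_(D,0,D-1) = 0. *)
definition listed :: "nat \<Rightarrow> (nat \<Rightarrow> complex) set" where
  "listed D = vec_of `
    (if D = 3 then
      {[1, -1]}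
     else if D = 4 then
      {[5, -6, 1]}
     else if D = 5 then
      {[1,  0, -3,  2],
       [0,  2, -5,  3],
       [3, -4,  1,  0],
       [5, -6,  0,  1],
       [1, -2,  2, -1]}
     else if D = 6 then
      {[77, -120, 60, -20, 3]}
     else if D = 7 then
      {[ 85, -144,   90,  -40,    9,  0],
       [ 82, -135,   75,  -25,    0,  3],
       [ 77, -120,   50,    0,  -15,  8],
       [ 67,  -90,    0,   50,  -45, 18],
       [ 37,    0, -150,  200, -135, 48],
       [  0,  111, -335,  385, -246, 85],
       [  1,   -3,    5,   -5,    3, -1]}
     else if D = 8 then
      {[669, -1260, 1050, -700, 315, -84, 10]}
     else {})"

end

theory Submission
  imports Defs
begin

text \<open>
  The mean value \<open>phi D 0 r f\<close> is unchanged when \<open>f\<close> is translated and is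
  multiplied by \<open>k\<close> when \<open>f\<close> is, so \<open>f\<close> may be taken monic with vanishing second
  coefficient.  Write the coefficients of such a polynomial with binomial weights,
  \<open>f = (\<Sum>j\<le>D. (D choose j) c\<^sub>j x\<^sup>D\<^sup>-\<^sup>j)\<close> with \<open>c\<^sub>0 = 1\<close> and \<open>c\<^sub>1 = 0\<close>.
  Up to a constant factor, the \<open>r\<close>-th derivative is then the polynomial of degree
  \<open>n = D - r\<close> built in the same way from the same sequence \<open>c\<close> (an Appell sequence,
  \<open>higher_pderiv_appell\<close>).  Newton's identities therefore give the mean power sums of the
  roots of all derivatives by a single recursion in which \<open>n\<close> enters only through
  binomial coefficients (\<open>mean_power_Suc\<close>).

  Consequently \<open>phi D 0 r f\<close> is a polynomial in \<open>c\<^sub>2, \<dots>, c\<^sub>D\<close> that is homogeneous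
  of weight \<open>D\<close> when \<open>c\<^sub>j\<close> has weight \<open>j\<close>.  For \<open>D \<le> 8\<close> it has at most seven monomials;
  the lemmas \<open>mean_values_2\<close> to \<open>mean_values_8\<close> tabulate them.  A vector \<open>a\<close> is a relation
  in degree \<open>D\<close> exactly if it is orthogonal to the column of each monomial in the table.

  For the listed vectors this is read off the table.  For the converse, sequences
  \<open>c\<close> with values 0 and 1 isolate one column after the other, and the resulting linear system
  is solved.  Its solutions form a space of dimension 0 for \<open>D = 2\<close>, of dimension 2 for \<open>D = 5\<close>
  and \<open>D = 7\<close>, and of dimension 1 for the other degrees, spanned by one or two of the listed
  vectors.  In particular three listed vectors of degree 5 or 7 lie in a plane and
  are dependent, while the minors in the first two coordinates show that any two of them are
  independent.
\<close>

section \<open>Newton's identities\<close>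

text \<open>
  For \<open>E = (\<Prod>z\<in>#A. 1 - z X)\<close> the logarithmic derivative satisfies
  \<open>X E' / E = - (\<Sum>z\<in>#A. z X / (1 - z X))\<close>, and the geometric series on the right add up to the
  generating function of the power sums.  After multiplication by \<open>E\<close> this can be proved factor by
  factor.
\<close>
lemma newton_identity_mset:
  fixes A :: "complex multiset"
  defines "E \<equiv> \<Prod>z\<in>#A. 1 - fps_const z * fps_X"
  shows "fps_X * fps_deriv E = - (E * Abs_fps (\<lambda>k. if k = 0 then 0 else \<Sum>z\<in>#A. z ^ k))"
  unfolding E_def
proof (induction A)
  case empty
  show ?case by (simp add: fps_eq_iff)
next
  case (add z A)
  define F where "F = (\<Prod>z\<in>#A. 1 - fps_const z * fps_X)"
  define P where "P = Abs_fps (\<lambda>k. if k = 0 then 0 else \<Sum>z\<in>#A. z ^ k)"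
  define G where "G = Abs_fps (\<lambda>k. if k = 0 then 0 else z ^ k)"
  have split: "Abs_fps (\<lambda>k. if k = 0 then 0 else \<Sum>z\<in>#add_mset z A. z ^ k) = P + G"
    by (auto simp: P_def G_def fps_eq_iff)
  have geo: "(1 - fps_const z * fps_X) * G = fps_const z * fps_X"
  proof (rule fps_ext)
    fix k
    have "((1 - fps_const z * fps_X) * G) $ k = G $ k - z * (fps_X * G) $ k"
      by (simp add: ring_distribs mult.assoc)
    also have "\<dots> = (fps_const z * fps_X) $ k"
      by (cases k) (auto simp: G_def)
    finally show "((1 - fps_const z * fps_X) * G) $ k = (fps_const z * fps_X) $ k" .
  qed
  have IH: "fps_X * fps_deriv F = - (F * P)"
    using add.IH by (simp add: F_def P_def)
  have "fps_X * fps_deriv ((1 - fps_const z * fps_X) * F)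
      = (1 - fps_const z * fps_X) * (fps_X * fps_deriv F) - (fps_const z * fps_X) * F"
    by (simp add: algebra_simps)
  also have "\<dots> = - ((1 - fps_const z * fps_X) * F * (P + G))"
    unfolding IH by (subst geo [symmetric]) (simp add: algebra_simps)
  finally show ?case
    unfolding split by (simp add: F_def)
qed

text \<open>
  Reversing the coefficients turns the factors \<open>x - z\<close> of \<open>p\<close> into \<open>1 - z x\<close>, so the claim
  is the comparison of the \<open>k\<close>-th coefficients in \<open>newton_identity_mset\<close>.  With the reversed
  polynomial there is no case distinction between \<open>k \<le> degree p\<close> and \<open>k > degree p\<close>.
\<close>
lemma newton_identity:
  fixes p :: "complex poly"
  shows "of_nat k * coeff (reflect_poly p) k
       = - (\<Sum>i<k. coeff (reflect_poly p) i * (\<Sum>z\<in>#proots p. z ^ (k - i)))"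
proof -
  define E where "E = (\<Prod>z\<in>#proots p. 1 - fps_const z * fps_X)"
  define P where "P = Abs_fps (\<lambda>k. if k = 0 then 0 else \<Sum>z\<in>#proots p. z ^ k)"
  have refl_linear: "fps_of_poly (reflect_poly [:-z, 1:]) = 1 - fps_const z * fps_X" for z :: complex
    by (rule fps_ext) (auto simp: coeff_reflect_poly coeff_pCons split: nat.splits)
  have refl_prod: "fps_of_poly (reflect_poly (\<Prod>z\<in>#A. [:-z, 1:]))
      = (\<Prod>z\<in>#A. 1 - fps_const z * fps_X)" for A :: "complex multiset"
    by (induction A)
       (simp_all add: reflect_poly_mult fps_of_poly_mult refl_linear
          del: mult_pCons_left mult_pCons_right)
  have factored: "fps_of_poly (reflect_poly p) = fps_const (lead_coeff p) * E"
    by (subst complex_poly_decompose_multiset [symmetric])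
       (simp add: reflect_poly_smult fps_of_poly_smult refl_prod E_def)
  have log_deriv: "fps_X * fps_deriv E = - (E * P)"
    unfolding E_def P_def by (rule newton_identity_mset)
  have "fps_X * fps_deriv (fps_of_poly (reflect_poly p))
      = fps_const (lead_coeff p) * (fps_X * fps_deriv E)"
    unfolding factored by (simp add: mult_ac)
  also have "\<dots> = - (fps_of_poly (reflect_poly p) * P)"
    unfolding factored log_deriv by (simp add: mult_ac)
  finally have "fps_X * fps_deriv (fps_of_poly (reflect_poly p)) = - (fps_of_poly (reflect_poly p) * P)" .
  then have "(fps_X * fps_deriv (fps_of_poly (reflect_poly p))) $ k
      = - (fps_of_poly (reflect_poly p) * P) $ k"
    by simp
  moreover have "(fps_X * fps_deriv (fps_of_poly (reflect_poly p))) $ k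
      = of_nat k * coeff (reflect_poly p) k"
    by (cases k) auto
  ultimately have "of_nat k * coeff (reflect_poly p) k
      = - (\<Sum>i=0..k. coeff (reflect_poly p) i * P $ (k - i))"
    by (simp add: fps_mult_nth)
  also have "(\<Sum>i=0..k. coeff (reflect_poly p) i * P $ (k - i))
      = (\<Sum>i<k. coeff (reflect_poly p) i * (\<Sum>z\<in>#proots p. z ^ (k - i)))"
    by (intro sum.mono_neutral_cong_right) (auto simp: P_def)
  finally show ?thesis .
qed

section \<open>Appell normal form\<close>

text \<open>
  The binomial weights make differentiation lower \<open>n\<close> and leave the sequence \<open>c\<close> unchanged,
  up to a constant factor.
\<close>
definition appell :: "(nat \<Rightarrow> complex) \<Rightarrow> nat \<Rightarrow> complex poly" where
  "appell c n = (\<Sum>i\<le>n. monom (of_nat (n choose i) * c (n - i)) i)"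

definition mean_power :: "(nat \<Rightarrow> complex) \<Rightarrow> nat \<Rightarrow> nat \<Rightarrow> complex" where
  "mean_power c n k = (\<Sum>z\<in>#proots (appell c n). z ^ k) / of_nat n"

lemma coeff_appell: "coeff (appell c n) i = of_nat (n choose i) * c (n - i)"
  by (simp add: appell_def coeff_sum sum.delta)

lemma degree_appell: "c 0 = 1 \<Longrightarrow> degree (appell c n) = n"
  by (intro antisym degree_le le_degree) (auto simp: coeff_appell)

lemma pderiv_appell: "pderiv (appell c (Suc n)) = smult (of_nat (Suc n)) (appell c n)"
proof (rule poly_eqI)
  fix i
  have "of_nat (Suc i * (Suc n choose Suc i)) = (of_nat (Suc n * (n choose i)) :: complex)"
    by (subst Suc_times_binomial) (rule refl)
  then show "coeff (pderiv (appell c (Suc n))) i = coeff (smult (of_nat (Suc n)) (appell c n)) i"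
    by (simp only: coeff_pderiv coeff_appell coeff_smult of_nat_mult mult.assoc [symmetric]) simp
qed

lemma higher_pderiv_appell:
  "\<exists>k. k \<noteq> 0 \<and> (pderiv ^^ r) (appell c (n + r)) = smult k (appell c n)"
proof (induction r)
  case 0
  show ?case by (auto intro: exI [of _ 1])
next
  case (Suc r)
  then obtain k where k: "k \<noteq> 0" "(pderiv ^^ r) (appell c (n + r)) = smult k (appell c n)"
    by blast
  have "(pderiv ^^ Suc r) (appell c (n + Suc r))
      = (pderiv ^^ r) (pderiv (appell c (Suc (n + r))))"
    by (simp add: funpow_swap1)
  also have "\<dots> = smult (of_nat (Suc (n + r)) * k) (appell c n)"
    by (simp only: pderiv_appell higher_pderiv_smult k(2) smult_smult)
  finally show ?case
    using k(1) by (metis mult_eq_0_iff of_nat_eq_0_iff nat.distinct(1))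
qed

lemma coeff_reflect_appell:
  assumes "c 0 = 1"
  shows "coeff (reflect_poly (appell c n)) k = of_nat (n choose k) * c k"
  using assms
  by (auto simp: coeff_reflect_poly degree_appell coeff_appell binomial_eq_0 binomial_symmetric [symmetric])

lemma mean_power_0: "c 0 = 1 \<Longrightarrow> n > 0 \<Longrightarrow> mean_power c n 0 = 1"
  by (simp add: mean_power_def size_proots_complex degree_appell)

text \<open>
  Newton's identity, divided by \<open>n\<close> and solved for the last power sum.  Working with means
  absorbs the factor \<open>k + 1\<close> of the identity, since
  \<open>(k + 1) (n choose (k + 1)) = n ((n - 1) choose k)\<close>.
\<close>
lemma mean_power_Suc:
  assumes "c 0 = 1" "n > 0"
  shows "mean_power c n (Suc k) =
    - of_nat (n - 1 choose k) * c (Suc k)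
    - (\<Sum>i<k. of_nat (n choose Suc i) * c (Suc i) * mean_power c n (k - i))"
proof -
  have *: "of_nat (Suc k) * (of_nat (n choose Suc k) * c (Suc k))
       = - (\<Sum>i<Suc k. of_nat (n choose i) * c i * (of_nat n * mean_power c n (Suc k - i)))"
    using newton_identity [of "Suc k" "appell c n"] assms
    by (simp add: coeff_reflect_appell mean_power_def)
  have "of_nat (Suc k) * of_nat (n choose Suc k) = (of_nat n * of_nat (n - 1 choose k) :: complex)"
    using assms Suc_times_binomial [of k "n - 1"] by (simp flip: of_nat_mult del: of_nat_Suc)
  moreover have "(\<Sum>i<Suc k. of_nat (n choose i) * c i * (of_nat n * mean_power c n (Suc k - i)))
      = of_nat n * (mean_power c n (Suc k)
        + (\<Sum>i<k. of_nat (n choose Suc i) * c (Suc i) * mean_power c n (k - i)))"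
    using assms
    by (subst sum.lessThan_Suc_shift)
       (simp add: sum_distrib_left distrib_left mult_ac del: binomial_Suc_Suc)
  ultimately have "of_nat n * (of_nat (n - 1 choose k) * c (Suc k)) =
    - (of_nat n * (mean_power c n (Suc k)
      + (\<Sum>i<k. of_nat (n choose Suc i) * c (Suc i) * mean_power c n (k - i))))"
    using * by (simp only: mult.assoc [symmetric])
  then have "of_nat n * (of_nat (n - 1 choose k) * c (Suc k)) =
    of_nat n * - (mean_power c n (Suc k)
      + (\<Sum>i<k. of_nat (n choose Suc i) * c (Suc i) * mean_power c n (k - i)))"
    by (simp only: mult_minus_right)
  then have "of_nat (n - 1 choose k) * c (Suc k) =
     - (mean_power c n (Suc k)
      + (\<Sum>i<k. of_nat (n choose Suc i) * c (Suc i) * mean_power c n (k - i)))"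
    using assms by (subst (asm) mult_cancel_left) simp
  then show ?thesis
    by (simp only: mult_minus_left) simp
qed

lemma phi_appell:
  assumes "c 0 = 1" "r < D"
  shows "phi D 0 r (appell c D)
       = (\<Sum>k\<le>D. of_nat (D choose k) * c (D - k) * mean_power c (D - r) k)"
proof -
  obtain k where "k \<noteq> 0" "(pderiv ^^ r) (appell c (D - r + r)) = smult k (appell c (D - r))"
    using higher_pderiv_appell by blast
  with assms(2) have "proots ((pderiv ^^ r) (appell c D)) = proots (appell c (D - r))"
    by simp
  moreover have "(\<Sum>z\<in>#A. poly (appell c D) z)
      = (\<Sum>k\<le>D. of_nat (D choose k) * c (D - k) * (\<Sum>z\<in>#A. z ^ k))" for A
    by (induction A)
       (auto simp: poly_altdef degree_appell assms coeff_appell distrib_left sum.distrib)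
  ultimately show ?thesis
    by (simp add: phi_def mean_power_def sum_divide_distrib)
qed

section \<open>Reduction to the normal form\<close>

lemma proots_pcompose_shift:
  fixes p :: "complex poly"
  assumes "p \<noteq> 0"
  shows "proots (pcompose p [:h, 1:]) = image_mset (\<lambda>z. z - h) (proots p)"
proof -
  have shift_prod: "pcompose (\<Prod>z\<in>#A. [:-z, 1:]) [:h, 1:] = (\<Prod>z\<in>#A. [:-(z - h), 1:])"
    for A :: "complex multiset"
  proof (induction A)
    case (add z A)
    have "pcompose [:-z, 1:] [:h, 1:] = [:-(z - h), 1:]"
      by (simp add: pcompose_pCons)
    with add show ?case
      by (simp only: image_mset_add_mset prod_mset.add_mset pcompose_mult)
  qed (simp add: pcompose_1)
  have roots_prod: "proots (\<Prod>z\<in>#A. [:-(z - h), 1:]) = image_mset (\<lambda>z. z - h) A"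
    for A :: "complex multiset"
  proof (induction A)
    case (add z A)
    have "(\<Prod>z\<in>#A. [:-(z - h), 1:]) \<noteq> 0"
      by (auto simp: prod_mset_zero_iff)
    then have "proots ([:-(z - h), 1:] * (\<Prod>z\<in>#A. [:-(z - h), 1:]))
        = proots [:-(z - h), 1:] + proots (\<Prod>z\<in>#A. [:-(z - h), 1:])"
      by (intro proots_mult) auto
    with add show ?case by (simp only: image_mset_add_mset prod_mset.add_mset proots_linear_factor) simp
  qed simp
  show ?thesis
    by (subst complex_poly_decompose_multiset [of p, symmetric])
       (use assms in \<open>simp only: pcompose_smult shift_prod proots_smult leading_coeff_0_iff roots_prod
          not_False_eq_True\<close>)
qed

lemma higher_pderiv_pcompose_shift:
  "(pderiv ^^ r) (pcompose p [:h, 1:]) = pcompose ((pderiv ^^ r) p) [:h, 1 :: complex:]"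
  by (induction r) (simp_all add: pderiv_pcompose pderiv_pCons one_pCons)

lemma pochhammer_of_nat_neq_0: "pochhammer (1 + of_nat m :: complex) r \<noteq> 0"
proof
  assume "pochhammer (1 + of_nat m :: complex) r = 0"
  then obtain k where "(1 + of_nat m :: complex) = - of_nat k"
    by (auto simp: pochhammer_eq_0_iff)
  then have "(1 + of_nat m) + of_nat k = (0 :: complex)"
    by simp
  then have "(of_nat (Suc (m + k)) :: complex) = 0"
    by (simp add: add.assoc)
  then show False
    by (simp only: of_nat_eq_0_iff)
qed

lemma phi_pcompose_shift:
  assumes "r \<le> degree f" "f \<noteq> 0"
  shows "phi D 0 r (pcompose f [:h, 1:]) = phi D 0 r f"
proof -
  have "(pderiv ^^ r) f \<noteq> 0"
  proof
    assume "(pderiv ^^ r) f = 0"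
    then have "coeff ((pderiv ^^ r) f) (degree f - r) = 0" by simp
    then show False
      using assms by (simp add: coeff_higher_pderiv pochhammer_of_nat_neq_0 del: of_nat_diff)
  qed
  then show ?thesis
    by (simp add: phi_def higher_pderiv_pcompose_shift proots_pcompose_shift poly_pcompose
        image_mset.compositionality o_def)
qed

lemma phi_smult: "k \<noteq> 0 \<Longrightarrow> phi D 0 r (smult k f) = k * phi D 0 r f"
  by (simp add: phi_def higher_pderiv_smult sum_mset_distrib_left)

text \<open>
  The translation moves the root of the linear polynomial \<open>(pderiv ^^ (D - 1)) f\<close>, which is the
  centroid of the roots of \<open>f\<close>, to the origin; this kills the coefficient of \<open>x\<^sup>D\<^sup>-\<^sup>1\<close>.
\<close>
lemma depressed_form:
  fixes f :: "complex poly"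
  assumes "degree f = D" "D > 0"
  obtains c h where "c 0 = 1" "c 1 = 0"
    "appell c D = smult (1 / lead_coeff f) (pcompose f [:h, 1:])"
proof -
  have "degree ((pderiv ^^ (D - 1)) f) > 0"
    using assms by (simp add: degree_higher_pderiv)
  then obtain h where h: "poly ((pderiv ^^ (D - 1)) f) h = 0"
    using fundamental_theorem_of_algebra [of "(pderiv ^^ (D - 1)) f"] constant_degree by (metis not_gr_zero)
  define g where "g = smult (1 / lead_coeff f) (pcompose f [:h, 1:])"
  define c where "c = (\<lambda>j. coeff g (D - j) / of_nat (D choose j))"
  have f0: "f \<noteq> 0" using assms by auto
  have lead: "coeff f D \<noteq> 0"
    by (metis f0 assms(1) leading_coeff_neq_0)
  then have deg: "degree g = D"
    using assms by (simp add: g_def degree_pcompose)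
  have monic: "coeff g D = 1"
  proof -
    have "lead_coeff (pcompose f [:h, 1:]) = lead_coeff f"
      by (subst lead_coeff_comp) auto
    then show ?thesis using assms lead by (simp add: g_def degree_pcompose)
  qed
  have "coeff g (D - 1) = 0"
  proof -
    have "poly ((pderiv ^^ (D - 1)) (pcompose f [:h, 1:])) 0 = 0"
      using h by (simp add: higher_pderiv_pcompose_shift poly_pcompose)
    then have "coeff ((pderiv ^^ (D - 1)) (pcompose f [:h, 1:])) 0 = 0"
      by (simp add: poly_0_coeff_0)
    then show ?thesis
      by (auto simp: coeff_higher_pderiv pochhammer_fact [symmetric] g_def)
  qed
  moreover have "appell c D = g"
  proof (rule poly_eqI)
    fix i show "coeff (appell c D) i = coeff g i"
    proof (cases "i \<le> D")
      case True
      then show ?thesis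
        by (simp add: coeff_appell c_def binomial_symmetric [symmetric])
    next
      case False
      then show ?thesis using deg by (simp add: coeff_appell coeff_eq_0)
    qed
  qed
  ultimately show ?thesis
    using that [of c h] monic by (simp add: c_def g_def)
qed

lemma relation_if_appell:
  assumes "degree f = D" "D > 0"
    and "\<And>c. c 0 = 1 \<Longrightarrow> c 1 = 0 \<Longrightarrow> relation D a (appell c D)"
  shows "relation D a f"
proof -
  obtain c h where c: "c 0 = 1" "c 1 = 0"
    "appell c D = smult (1 / lead_coeff f) (pcompose f [:h, 1:])"
    using depressed_form assms by metis
  have f0: "f \<noteq> 0" using assms by auto
  have "phi D 0 r (appell c D) = phi D 0 r f / lead_coeff f" if "r \<in> {1..D-1}" for r
    using that assms f0 by (subst c(3), subst phi_smult) (auto simp: phi_pcompose_shift)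
  then have "(\<Sum>r=1..D-1. a r * phi D 0 r (appell c D)) = (\<Sum>r=1..D-1. a r * phi D 0 r f) / lead_coeff f"
    by (simp add: sum_divide_distrib)
  then show ?thesis
    using assms(3)[OF c(1,2)] f0 by (simp add: relation_def)
qed

section \<open>Tables of the mean values up to degree 8\<close>

text \<open>
  Pascal's rule as a rewrite rule for binomial coefficients of numerals; together with the boundary
  values below it lets the simplifier evaluate them.
\<close>
lemma choose_numeral:
  "numeral n choose numeral k
     = (pred_numeral n choose pred_numeral k) + (pred_numeral n choose numeral k)"
  by (simp add: numeral_eq_Suc)

lemma choose_numeral_eq_0:
  "0 choose numeral k = 0"
  "Suc 0 choose numeral (Num.Bit0 k) = 0"
  "Suc 0 choose numeral (Num.Bit1 k) = 0"
  by (simp_all add: binomial_eq_0)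

text \<open>
  Each mean power sum is left in terms of the earlier ones: for a concrete \<open>n\<close> these
  formulas, used as rewrite rules, compute everything without a closed form in \<open>n\<close>.
\<close>
lemma mean_power_depressed:
  assumes "c 0 = 1" "c 1 = 0" "n > 0"
  shows "mean_power c n 0 = 1"
    "mean_power c n (Suc 0) = 0"
    "mean_power c n 2 = - of_nat (n - 1 choose 1) * c 2"
    "mean_power c n 3 = - of_nat (n - 1 choose 2) * c 3"
    "mean_power c n 4 = - of_nat (n - 1 choose 3) * c 4
         - of_nat (n choose 2) * c 2 * mean_power c n 2"
    "mean_power c n 5 = - of_nat (n - 1 choose 4) * c 5
         - of_nat (n choose 2) * c 2 * mean_power c n 3
         - of_nat (n choose 3) * c 3 * mean_power c n 2"
    "mean_power c n 6 = - of_nat (n - 1 choose 5) * c 6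
         - of_nat (n choose 2) * c 2 * mean_power c n 4
         - of_nat (n choose 3) * c 3 * mean_power c n 3
         - of_nat (n choose 4) * c 4 * mean_power c n 2"
    "mean_power c n 7 = - of_nat (n - 1 choose 6) * c 7
         - of_nat (n choose 2) * c 2 * mean_power c n 5
         - of_nat (n choose 3) * c 3 * mean_power c n 4
         - of_nat (n choose 4) * c 4 * mean_power c n 3
         - of_nat (n choose 5) * c 5 * mean_power c n 2"
    "mean_power c n 8 = - of_nat (n - 1 choose 7) * c 8
         - of_nat (n choose 2) * c 2 * mean_power c n 6
         - of_nat (n choose 3) * c 3 * mean_power c n 5
         - of_nat (n choose 4) * c 4 * mean_power c n 4
         - of_nat (n choose 5) * c 5 * mean_power c n 3
         - of_nat (n choose 6) * c 6 * mean_power c n 2"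
proof -
  note rec = mean_power_Suc [of c n, OF assms(1,3)]
  have "c (Suc 0) = 0" using assms(2) by simp
  note facts = assms this
  note expand = lessThan_nat_numeral lessThan_Suc numeral_2_eq_2 [symmetric]
  show zero: "mean_power c n 0 = 1"
    using facts by (simp add: mean_power_0)
  show one: "mean_power c n (Suc 0) = 0"
    using facts rec [of 0] by simp
  show "mean_power c n 2 = - of_nat (n - 1 choose 1) * c 2"
    using facts one rec [of 1] by (simp add: expand)
  show "mean_power c n 3 = - of_nat (n - 1 choose 2) * c 3"
    using facts one rec [of 2] by (simp add: expand)
  show "mean_power c n 4 = - of_nat (n - 1 choose 3) * c 4
         - of_nat (n choose 2) * c 2 * mean_power c n 2"
    using facts one rec [of 3] by (simp add: expand)
  show "mean_power c n 5 = - of_nat (n - 1 choose 4) * c 5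
         - of_nat (n choose 2) * c 2 * mean_power c n 3
         - of_nat (n choose 3) * c 3 * mean_power c n 2"
    using facts one rec [of 4] by (simp add: expand)
  show "mean_power c n 6 = - of_nat (n - 1 choose 5) * c 6
         - of_nat (n choose 2) * c 2 * mean_power c n 4
         - of_nat (n choose 3) * c 3 * mean_power c n 3
         - of_nat (n choose 4) * c 4 * mean_power c n 2"
    using facts one rec [of 5] by (simp add: expand)
  show "mean_power c n 7 = - of_nat (n - 1 choose 6) * c 7
         - of_nat (n choose 2) * c 2 * mean_power c n 5
         - of_nat (n choose 3) * c 3 * mean_power c n 4
         - of_nat (n choose 4) * c 4 * mean_power c n 3
         - of_nat (n choose 5) * c 5 * mean_power c n 2"
    using facts one rec [of 6] by (simp add: expand)
  show "mean_power c n 8 = - of_nat (n - 1 choose 7) * c 8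
         - of_nat (n choose 2) * c 2 * mean_power c n 6
         - of_nat (n choose 3) * c 3 * mean_power c n 5
         - of_nat (n choose 4) * c 4 * mean_power c n 4
         - of_nat (n choose 5) * c 5 * mean_power c n 3
         - of_nat (n choose 6) * c 6 * mean_power c n 2"
    using facts one rec [of 7] by (simp add: expand)
qed

lemmas mean_value_simps =
  phi_appell mean_power_depressed atMost_nat_numeral atMost_Suc choose_numeral choose_numeral_eq_0
  algebra_simps power2_eq_square power3_eq_cube power4_eq_xxxx

text \<open>
  Only the top coefficient \<open>c\<^sub>D\<close> and products of at least two factors \<open>c\<^sub>j\<close> with
  \<open>j \<ge> 2\<close> and indices adding up to \<open>D\<close> survive.
\<close>
lemma mean_values_2:
  assumes "c 0 = 1" "c 1 = 0"
  shows
    "phi 2 0 1 (appell c 2) = c 2"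
  using assms
  by (simp_all add: mean_value_simps)

lemma mean_values_3:
  assumes "c 0 = 1" "c 1 = 0"
  shows
    "phi 3 0 1 (appell c 3) = c 3"
    "phi 3 0 2 (appell c 3) = c 3"
  using assms
  by (simp_all add: mean_value_simps)

lemma mean_values_4:
  assumes "c 0 = 1" "c 1 = 0"
  shows
    "phi 4 0 1 (appell c 4) = c 4 - 6 * c 2 ^ 2"
    "phi 4 0 2 (appell c 4) = c 4 - 5 * c 2 ^ 2"
    "phi 4 0 3 (appell c 4) = c 4"
  using assms
  by (simp_all add: mean_value_simps)

lemma mean_values_5:
  assumes "c 0 = 1" "c 1 = 0"
  shows
    "phi 5 0 1 (appell c 5) = c 5 - 30 * c 2 * c 3"
    "phi 5 0 2 (appell c 5) = c 5 - 25 * c 2 * c 3"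
    "phi 5 0 3 (appell c 5) = c 5 - 10 * c 2 * c 3"
    "phi 5 0 4 (appell c 5) = c 5"
  using assms
  by (simp_all add: mean_value_simps)

lemma mean_values_6:
  assumes "c 0 = 1" "c 1 = 0"
  shows
    "phi 6 0 1 (appell c 6) = c 6 - 60 * c 2 * c 4 - 60 * c 3 ^ 2 + 200 * c 2 ^ 3"
    "phi 6 0 2 (appell c 6) = c 6 - 51 * c 2 * c 4 - 48 * c 3 ^ 2 + 162 * c 2 ^ 3"
    "phi 6 0 3 (appell c 6) = c 6 - 30 * c 2 * c 4 - 19 * c 3 ^ 2 + 72 * c 2 ^ 3"
    "phi 6 0 4 (appell c 6) = c 6 - 15 * c 2 * c 4 + 14 * c 2 ^ 3"
    "phi 6 0 5 (appell c 6) = c 6"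
  using assms
  by (simp_all add: mean_value_simps)

lemma mean_values_7:
  assumes "c 0 = 1" "c 1 = 0"
  shows
    "phi 7 0 1 (appell c 7) = c 7 - 105 * c 2 * c 5 - 350 * c 3 * c 4 + 2625 * c 2 ^ 2 * c 3"
    "phi 7 0 2 (appell c 7) = c 7 - 91 * c 2 * c 5 - 280 * c 3 * c 4 + 2100 * c 2 ^ 2 * c 3"
    "phi 7 0 3 (appell c 7) = c 7 - 63 * c 2 * c 5 - 133 * c 3 * c 4 + 1008 * c 2 ^ 2 * c 3"
    "phi 7 0 4 (appell c 7) = c 7 - 42 * c 2 * c 5 - 35 * c 3 * c 4 + 294 * c 2 ^ 2 * c 3"
    "phi 7 0 5 (appell c 7) = c 7 - 21 * c 2 * c 5 + 35 * c 2 ^ 2 * c 3"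
    "phi 7 0 6 (appell c 7) = c 7"
  using assms
  by (simp_all add: mean_value_simps)

lemma mean_values_8:
  assumes "c 0 = 1" "c 1 = 0"
  shows
    "phi 8 0 1 (appell c 8) = c 8 - 168 * c 2 * c 6 - 840 * c 3 * c 5 - 700 * c 4 ^ 2
        + 8820 * c 2 ^ 2 * c 4 + 14700 * c 2 * c 3 ^ 2 - 18522 * c 2 ^ 4"
    "phi 8 0 2 (appell c 8) = c 8 - 148 * c 2 * c 6 - 680 * c 3 * c 5 - 550 * c 4 ^ 2
        + 7050 * c 2 ^ 2 * c 4 + 11600 * c 2 * c 3 ^ 2 - 14625 * c 2 ^ 4"
    "phi 8 0 3 (appell c 8) = c 8 - 112 * c 2 * c 6 - 376 * c 3 * c 5 - 260 * c 4 ^ 2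
        + 3680 * c 2 ^ 2 * c 4 + 5680 * c 2 * c 3 ^ 2 - 7200 * c 2 ^ 4"
    "phi 8 0 4 (appell c 8) = c 8 - 84 * c 2 * c 6 - 168 * c 3 * c 5 - 69 * c 4 ^ 2
        + 1440 * c 2 ^ 2 * c 4 + 1824 * c 2 * c 3 ^ 2 - 2376 * c 2 ^ 4"
    "phi 8 0 5 (appell c 8) = c 8 - 56 * c 2 * c 6 - 56 * c 3 * c 5
        + 420 * c 2 ^ 2 * c 4 + 300 * c 2 * c 3 ^ 2 - 450 * c 2 ^ 4"
    "phi 8 0 6 (appell c 8) = c 8 - 28 * c 2 * c 6 + 70 * c 2 ^ 2 * c 4 - 27 * c 2 ^ 4"
    "phi 8 0 7 (appell c 8) = c 8"
  using assms
  by (simp_all add: mean_value_simps)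

section \<open>The space of all relations\<close>

definition relation_space :: "nat \<Rightarrow> (nat \<Rightarrow> complex) set" where
  "relation_space D = {a \<in> vecs (D - 1). \<forall>f. degree f = D \<longrightarrow> relation D a f}"

lemma relation_space_appell:
  "a \<in> relation_space D \<Longrightarrow> c 0 = 1 \<Longrightarrow> relation D a (appell c D)"
  by (simp add: relation_space_def degree_appell)

lemma vecs_eqI:
  assumes "a \<in> vecs n" "b \<in> vecs n" "\<And>i. i \<in> {1..n} \<Longrightarrow> a i = b i"
  shows "a = b"
proof
  fix i show "a i = b i"
    using assms by (cases "i \<in> {1..n}") (auto simp: vecs_def)
qed

lemma vec_of_in_vecs: "length xs = n \<Longrightarrow> vec_of xs \<in> vecs n"
  by (auto simp: vec_of_def vecs_def)

lemma in_span_pair: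
  assumes "a \<in> vecs n" "length xs = n" "length ys = n"
    and "\<And>i. i \<in> {1..n} \<Longrightarrow> a i = s * vec_of xs i + t * vec_of ys i"
  shows "a \<in> cvec.span {vec_of xs, vec_of ys}"
proof -
  have "a = scale_vec s (vec_of xs) + scale_vec t (vec_of ys)"
    using assms vec_of_in_vecs [of xs n] vec_of_in_vecs [of ys n]
    by (intro vecs_eqI [of _ n]) (auto simp: vecs_def scale_vec_def)
  then show ?thesis
    by (simp add: cvec.span_add cvec.span_base cvec.span_scale)
qed

lemma in_span_single:
  assumes "a \<in> vecs n" "length xs = n" "\<And>i. i \<in> {1..n} \<Longrightarrow> a i = s * vec_of xs i"
  shows "a \<in> cvec.span {vec_of xs}"
  using in_span_pair [of a n xs xs s 0] assms by simp

lemma relation_expand: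
  "relation 2 a f \<longleftrightarrow> a 1 * phi 2 0 1 f = 0"
  "relation 3 a f \<longleftrightarrow> a 1 * phi 3 0 1 f + a 2 * phi 3 0 2 f = 0"
  "relation 4 a f \<longleftrightarrow> a 1 * phi 4 0 1 f + a 2 * phi 4 0 2 f + a 3 * phi 4 0 3 f = 0"
  "relation 5 a f \<longleftrightarrow> a 1 * phi 5 0 1 f + a 2 * phi 5 0 2 f + a 3 * phi 5 0 3 f
       + a 4 * phi 5 0 4 f = 0"
  "relation 6 a f \<longleftrightarrow> a 1 * phi 6 0 1 f + a 2 * phi 6 0 2 f + a 3 * phi 6 0 3 f
       + a 4 * phi 6 0 4 f + a 5 * phi 6 0 5 f = 0"
  "relation 7 a f \<longleftrightarrow> a 1 * phi 7 0 1 f + a 2 * phi 7 0 2 f + a 3 * phi 7 0 3 f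
       + a 4 * phi 7 0 4 f + a 5 * phi 7 0 5 f + a 6 * phi 7 0 6 f = 0"
  "relation 8 a f \<longleftrightarrow> a 1 * phi 8 0 1 f + a 2 * phi 8 0 2 f + a 3 * phi 8 0 3 f
       + a 4 * phi 8 0 4 f + a 5 * phi 8 0 5 f + a 6 * phi 8 0 6 f + a 7 * phi 8 0 7 f = 0"
  by (simp_all add: relation_def sum.atLeast1_atMost_eq lessThan_nat_numeral lessThan_Suc
        numeral_2_eq_2 [symmetric] add_ac)

lemmas coefficient_simps =
  relation_expand mean_values_2 mean_values_3 mean_values_4 mean_values_5
  mean_values_6 mean_values_7 mean_values_8

lemma listed_relation:
  assumes "D \<in> {3..8}" "a \<in> listed D" "c 0 = 1" "c 1 = 0"
  shows "relation D a (appell c D)"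
proof -
  have "D = 3 \<or> D = 4 \<or> D = 5 \<or> D = 6 \<or> D = 7 \<or> D = 8"
    using assms(1) by auto
  then show ?thesis
    using assms(2-4)
    by (elim disjE; simp add: listed_def del: One_nat_def)
       (auto simp: vec_of_def coefficient_simps algebra_simps simp del: One_nat_def)
qed

lemma listed_in_vecs: "listed D \<subseteq> vecs (D - 1)"
  by (auto simp: listed_def intro!: vec_of_in_vecs)

lemma listed_subset_relation_space: "D \<in> {3..8} \<Longrightarrow> listed D \<subseteq> relation_space D"
  using listed_in_vecs [of D] listed_relation [of D] relation_if_appell [of _ D]
  by (auto simp: relation_space_def)

section \<open>Solving for all relations\<close>

text \<open>
  The test sequences: a monomial in \<open>c\<^sub>2, c\<^sub>3, \<dots>\<close> takes the value 1 on \<open>support_seq J\<close> if all its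
  indices lie in \<open>J\<close>, and 0 otherwise.
\<close>
definition support_seq :: "nat set \<Rightarrow> nat \<Rightarrow> complex" where
  "support_seq J j = (if j = 0 \<or> j \<in> J then 1 else 0)"

text \<open>
  In the following lemmas, the equation named after the indices of a monomial says that \<open>a\<close> is
  orthogonal to the column of this monomial: \<open>e224\<close> belongs to \<open>c\<^sub>2\<^sup>2 c\<^sub>4\<close>.  Testing with the support
  of the monomial yields the sum of the columns of all monomials with that support or a
  smaller one, and the columns found before are subtracted; common factors are cancelled.
  The top coefficient \<open>c\<^sub>D\<close> has a column of ones.
\<close>
lemma relation_space_2:
  assumes "a \<in> relation_space 2"
  shows "a = 0"
proof -
  note test = relation_space_appell [OF assms]
  have e2: "a 1 = 0"
    using test [of "support_seq {2}"]
    by (simp add: coefficient_simps support_seq_def del: One_nat_def; algebra)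
  show ?thesis
    using assms e2 by (intro vecs_eqI [of _ 1]) (auto simp: relation_space_def vecs_def)
qed

lemma relation_space_3:
  assumes "a \<in> relation_space 3"
  shows "a \<in> cvec.span {vec_of [1, -1]}"
proof -
  note test = relation_space_appell [OF assms]
  have e3: "a 1 + a 2 = 0"
    using test [of "support_seq {3}"]
    by (simp add: coefficient_simps support_seq_def del: One_nat_def; algebra)
  define s where "s = - a 2"
  have c2: "a 2 = - s"
    by (simp add: s_def)
  have c1: "a 1 = s"
    using e3 c2 by algebra
  show ?thesis
  proof (rule in_span_single [of _ 2 _ s])
    show "a \<in> vecs 2"
      using assms by (simp add: relation_space_def)
    fix i :: nat assume "i \<in> {1..2}"
    then have "i = 1 \<or> i = 2"
      by auto
    then show "a i = s * vec_of [1, -1] i"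
      using c1 c2 by (elim disjE; simp add: vec_of_def mult.commute)
  qed simp_all
qed

lemma relation_space_4:
  assumes "a \<in> relation_space 4"
  shows "a \<in> cvec.span {vec_of [5, -6, 1]}"
proof -
  note test = relation_space_appell [OF assms]
  have e4: "a 1 + a 2 + a 3 = 0"
    using test [of "support_seq {4}"]
    by (simp add: coefficient_simps support_seq_def del: One_nat_def; algebra)
  have e22: "6 * a 1 + 5 * a 2 = 0"
    using test [of "support_seq {2}"]
    by (simp add: coefficient_simps support_seq_def del: One_nat_def; algebra)
  define s where "s = a 3"
  have c3: "a 3 = s"
    by (simp add: s_def)
  have c1: "a 1 = 5 * s"
    using e4 e22 c3 by algebra
  have c2: "a 2 = - 6 * s"
    using e4 e22 c3 by algebra
  show ?thesis
  proof (rule in_span_single [of _ 3 _ s])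
    show "a \<in> vecs 3"
      using assms by (simp add: relation_space_def)
    fix i :: nat assume "i \<in> {1..3}"
    then have "i = 1 \<or> i = 2 \<or> i = 3"
      by auto
    then show "a i = s * vec_of [5, -6, 1] i"
      using c1 c2 c3 by (elim disjE; simp add: vec_of_def mult.commute)
  qed simp_all
qed

lemma relation_space_5:
  assumes "a \<in> relation_space 5"
  shows "a \<in> cvec.span {vec_of [3, -4, 1, 0],
    vec_of [5, -6, 0, 1]}"
proof -
  note test = relation_space_appell [OF assms]
  have e5: "a 1 + a 2 + a 3 + a 4 = 0"
    using test [of "support_seq {5}"]
    by (simp add: coefficient_simps support_seq_def del: One_nat_def; algebra)
  have e23: "6 * a 1 + 5 * a 2 + 2 * a 3 = 0"
    using test [of "support_seq {2, 3}"]
    by (simp add: coefficient_simps support_seq_def del: One_nat_def; algebra)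
  define s where "s = a 3"
  define t where "t = a 4"
  have c3: "a 3 = s"
    by (simp add: s_def)
  have c4: "a 4 = t"
    by (simp add: t_def)
  have c1: "a 1 = 3 * s + 5 * t"
    using e5 e23 c3 c4 by algebra
  have c2: "a 2 = - 4 * s - 6 * t"
    using e5 e23 c3 c4 by algebra
  show ?thesis
  proof (rule in_span_pair [of _ 4 _ _ s t])
    show "a \<in> vecs 4"
      using assms by (simp add: relation_space_def)
    fix i :: nat assume "i \<in> {1..4}"
    then have "i = 1 \<or> i = 2 \<or> i = 3 \<or> i = 4"
      by auto
    then show "a i = s * vec_of [3, -4, 1, 0] i + t * vec_of [5, -6, 0, 1] i"
      using c1 c2 c3 c4 by (elim disjE; simp add: vec_of_def mult.commute)
  qed simp_all
qed

lemma relation_space_6: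
  assumes "a \<in> relation_space 6"
  shows "a \<in> cvec.span {vec_of [77, -120, 60, -20, 3]}"
proof -
  note test = relation_space_appell [OF assms]
  have e6: "a 1 + a 2 + a 3 + a 4 + a 5 = 0"
    using test [of "support_seq {6}"]
    by (simp add: coefficient_simps support_seq_def del: One_nat_def; algebra)
  have e33: "60 * a 1 + 48 * a 2 + 19 * a 3 = 0"
    using test [of "support_seq {3}"]
    by (simp add: coefficient_simps support_seq_def del: One_nat_def; algebra)
  have e222: "100 * a 1 + 81 * a 2 + 36 * a 3 + 7 * a 4 = 0"
    using test [of "support_seq {2}"]
    by (simp add: coefficient_simps support_seq_def del: One_nat_def; algebra)
  \<comment> \<open>the columns of \<open>c\<^sub>2 c\<^sub>4\<close> and \<open>c\<^sub>2\<^sup>3\<close> together\<close>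
  have "140 * a 1 + 111 * a 2 + 42 * a 3 - a 4 = 0"
    using test [of "support_seq {2, 4}"]
    by (simp add: coefficient_simps support_seq_def mult.commute del: One_nat_def)
  with e222 have e24: "20 * a 1 + 17 * a 2 + 10 * a 3 + 5 * a 4 = 0"
    by algebra
  define s where "s = a 5 / 3"
  have c5: "a 5 = 3 * s"
    by (simp add: s_def)
  have c1: "a 1 = 77 * s"
    using e6 e33 e222 e24 c5 by algebra
  have c2: "a 2 = - 120 * s"
    using e6 e33 e222 e24 c5 by algebra
  have c3: "a 3 = 60 * s"
    using e6 e33 e222 e24 c5 by algebra
  have c4: "a 4 = - 20 * s"
    using e6 e33 e222 e24 c5 by algebra
  show ?thesis
  proof (rule in_span_single [of _ 5 _ s])
    show "a \<in> vecs 5"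
      using assms by (simp add: relation_space_def)
    fix i :: nat assume "i \<in> {1..5}"
    then have "i = 1 \<or> i = 2 \<or> i = 3 \<or> i = 4 \<or> i = 5"
      by auto
    then show "a i = s * vec_of [77, -120, 60, -20, 3] i"
      using c1 c2 c3 c4 c5 by (elim disjE; simp add: vec_of_def mult.commute)
  qed simp_all
qed

lemma relation_space_7:
  assumes "a \<in> relation_space 7"
  shows "a \<in> cvec.span {vec_of [85, -144, 90, -40, 9, 0],
    vec_of [82, -135, 75, -25, 0, 3]}"
proof -
  note test = relation_space_appell [OF assms]
  have e7: "a 1 + a 2 + a 3 + a 4 + a 5 + a 6 = 0"
    using test [of "support_seq {7}"]
    by (simp add: coefficient_simps support_seq_def del: One_nat_def; algebra)
  have e223: "375 * a 1 + 300 * a 2 + 144 * a 3 + 42 * a 4 + 5 * a 5 = 0"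
    using test [of "support_seq {2, 3}"]
    by (simp add: coefficient_simps support_seq_def del: One_nat_def; algebra)
  have e34: "50 * a 1 + 40 * a 2 + 19 * a 3 + 5 * a 4 = 0"
    using test [of "support_seq {3, 4}"]
    by (simp add: coefficient_simps support_seq_def del: One_nat_def; algebra)
  have e25: "15 * a 1 + 13 * a 2 + 9 * a 3 + 6 * a 4 + 3 * a 5 = 0"
    using test [of "support_seq {2, 5}"]
    by (simp add: coefficient_simps support_seq_def del: One_nat_def; algebra)
  define s where "s = a 5 / 9"
  define t where "t = a 6 / 3"
  have c5: "a 5 = 9 * s"
    by (simp add: s_def)
  have c6: "a 6 = 3 * t"
    by (simp add: t_def)
  have c1: "a 1 = 85 * s + 82 * t"
    using e7 e223 e34 e25 c5 c6 by algebra
  have c2: "a 2 = - 144 * s - 135 * t"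
    using e7 e223 e34 e25 c5 c6 by algebra
  have c3: "a 3 = 90 * s + 75 * t"
    using e7 e223 e34 e25 c5 c6 by algebra
  have c4: "a 4 = - 40 * s - 25 * t"
    using e7 e223 e34 e25 c5 c6 by algebra
  show ?thesis
  proof (rule in_span_pair [of _ 6 _ _ s t])
    show "a \<in> vecs 6"
      using assms by (simp add: relation_space_def)
    fix i :: nat assume "i \<in> {1..6}"
    then have "i = 1 \<or> i = 2 \<or> i = 3 \<or> i = 4 \<or> i = 5 \<or> i = 6"
      by auto
    then show "a i = s * vec_of [85, -144, 90, -40, 9, 0] i
        + t * vec_of [82, -135, 75, -25, 0, 3] i"
      using c1 c2 c3 c4 c5 c6 by (elim disjE; simp add: vec_of_def mult.commute)
  qed simp_all
qed

lemma relation_space_8: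
  assumes "a \<in> relation_space 8"
  shows "a \<in> cvec.span {vec_of [669, -1260, 1050, -700, 315, -84, 10]}"
proof -
  note test = relation_space_appell [OF assms]
  have e8: "a 1 + a 2 + a 3 + a 4 + a 5 + a 6 + a 7 = 0"
    using test [of "support_seq {8}"]
    by (simp add: coefficient_simps support_seq_def del: One_nat_def; algebra)
  have e44: "700 * a 1 + 550 * a 2 + 260 * a 3 + 69 * a 4 = 0"
    using test [of "support_seq {4}"]
    by (simp add: coefficient_simps support_seq_def del: One_nat_def; algebra)
  have e35: "105 * a 1 + 85 * a 2 + 47 * a 3 + 21 * a 4 + 7 * a 5 = 0"
    using test [of "support_seq {3, 5}"]
    by (simp add: coefficient_simps support_seq_def del: One_nat_def; algebra)
  have e2222: "2058 * a 1 + 1625 * a 2 + 800 * a 3 + 264 * a 4 + 50 * a 5 + 3 * a 6 = 0"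
    using test [of "support_seq {2}"]
    by (simp add: coefficient_simps support_seq_def del: One_nat_def; algebra)
  have e233: "3675 * a 1 + 2900 * a 2 + 1420 * a 3 + 456 * a 4 + 75 * a 5 = 0"
    using test [of "support_seq {2, 3}"] e2222
    by (simp add: coefficient_simps support_seq_def del: One_nat_def; algebra)
  have e224: "882 * a 1 + 705 * a 2 + 368 * a 3 + 144 * a 4 + 42 * a 5 + 7 * a 6 = 0"
    using test [of "support_seq {2, 4}"] e44 e2222
    by (simp add: coefficient_simps support_seq_def del: One_nat_def; algebra)
  have e26: "42 * a 1 + 37 * a 2 + 28 * a 3 + 21 * a 4 + 14 * a 5 + 7 * a 6 = 0"
    using test [of "support_seq {2, 6}"] e2222
    by (simp add: coefficient_simps support_seq_def del: One_nat_def; algebra)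
  define s where "s = a 7 / 10"
  have c7: "a 7 = 10 * s"
    by (simp add: s_def)
  have c1: "a 1 = 669 * s"
    using e8 e44 e35 e2222 e233 e224 e26 c7 by algebra
  have c2: "a 2 = - 1260 * s"
    using e8 e44 e35 e2222 e233 e224 e26 c7 by algebra
  have c3: "a 3 = 1050 * s"
    using e8 e44 e35 e2222 e233 e224 e26 c7 by algebra
  have c4: "a 4 = - 700 * s"
    using e8 e44 e35 e2222 e233 e224 e26 c7 by algebra
  have c5: "a 5 = 315 * s"
    using e8 e44 e35 e2222 e233 e224 e26 c7 by algebra
  have c6: "a 6 = - 84 * s"
    using e8 e44 e35 e2222 e233 e224 e26 c7 by algebra
  show ?thesis
  proof (rule in_span_single [of _ 7 _ s])
    show "a \<in> vecs 7"
      using assms by (simp add: relation_space_def)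
    fix i :: nat assume "i \<in> {1..7}"
    then have "i = 1 \<or> i = 2 \<or> i = 3 \<or> i = 4 \<or> i = 5 \<or> i = 6 \<or> i = 7"
      by auto
    then show "a i = s * vec_of [669, -1260, 1050, -700, 315, -84, 10] i"
      using c1 c2 c3 c4 c5 c6 c7 by (elim disjE; simp add: vec_of_def mult.commute)
  qed simp_all
qed

section \<open>Linear dependence of the listed vectors\<close>

lemma dependent_if_in_plane:
  assumes "S \<subseteq> cvec.span {u, v}" "card S = 3"
  shows "cvec.dependent S"
proof (rule ccontr)
  assume "\<not> cvec.dependent S"
  then have "card S \<le> card {u, v}"
    using assms by (intro conjunct2 [OF cvec.independent_span_bound]) auto
  also have "\<dots> \<le> 2"
    by (simp add: card_insert_if)
  finally show False
    using assms by simp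
qed

lemma independent_pair:
  assumes "u i * v j \<noteq> u j * v i"
  shows "cvec.independent {u, v}"
proof -
  have "v \<noteq> 0" using assms by auto
  moreover have "u \<notin> cvec.span {v}"
  proof
    assume "u \<in> cvec.span {v}"
    then obtain k where "u = scale_vec k v"
      by (auto simp: cvec.span_singleton)
    then show False using assms by (simp add: scale_vec_def)
  qed
  ultimately show ?thesis
    by (simp add: cvec.independent_insert)
qed

lemma listed_minor:
  assumes "D = 5 \<or> D = 7" "u \<in> listed D" "v \<in> listed D" "u \<noteq> v"
  shows "u 1 * v 2 \<noteq> u 2 * v 1"
  using assms by (auto simp: listed_def vec_of_def)

lemma listed_triples_and_pairs:
  assumes "D = 5 \<or> D = 7" "S \<subseteq> listed D"
  shows "card S = 3 \<Longrightarrow> cvec.dependent S" "card S = 2 \<Longrightarrow> cvec.independent S"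
proof -
  have "listed D \<subseteq> relation_space D"
    using assms(1) by (intro listed_subset_relation_space) auto
  then obtain u v where "listed D \<subseteq> cvec.span {u, v}"
    using assms(1) relation_space_5 relation_space_7 by blast
  with assms(2) show "cvec.dependent S" if "card S = 3"
    using dependent_if_in_plane that by blast
  show "cvec.independent S" if "card S = 2"
  proof -
    obtain u v where S: "S = {u, v}" "u \<noteq> v"
      using \<open>card S = 2\<close> by (auto simp: card_2_iff)
    then have "u 1 * v 2 \<noteq> u 2 * v 1"
      using assms by (intro listed_minor) auto
    then show ?thesis
      unfolding S(1) by (rule independent_pair)
  qed
qed

section \<open>The complete list of relations\<close>

lemma relation_space_in_span:
  assumes "D \<in> {2..8}" "a \<in> relation_space D"
  shows "a \<in> cvec.span (listed D)"
proof -
  have "D = 2 \<or> D = 3 \<or> D = 4 \<or> D = 5 \<or> D = 6 \<or> D = 7 \<or> D = 8"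
    using assms(1) by auto
  then obtain B where "B \<subseteq> listed D" "a \<in> cvec.span B"
    using assms(2)
  proof (elim disjE)
    assume "D = 2" then show ?thesis using that [of "{}"] assms relation_space_2 by auto
  next
    assume "D = 3" then show ?thesis using that [OF _ relation_space_3] assms by (auto simp: listed_def)
  next
    assume "D = 4" then show ?thesis using that [OF _ relation_space_4] assms by (auto simp: listed_def)
  next
    assume "D = 5" then show ?thesis using that [OF _ relation_space_5] assms by (auto simp: listed_def)
  next
    assume "D = 6" then show ?thesis using that [OF _ relation_space_6] assms by (auto simp: listed_def)
  next
    assume "D = 7" then show ?thesis using that [OF _ relation_space_7] assms by (auto simp: listed_def)
  next
    assume "D = 8" then show ?thesis using that [OF _ relation_space_8] assms by (auto simp: listed_def)
  qed
  then show ?thesis using cvec.span_mono by blast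
qed

theorem proposition2:
  shows "(\<forall>D\<in>{3..8}. \<forall>a\<in>listed D. \<forall>f :: complex poly. degree f = D \<longrightarrow> relation D a f)
    \<and> (\<forall>D\<in>{5, 7}. \<forall>S\<subseteq>listed D.
          (card S = 3 \<longrightarrow> cvec.dependent S) \<and>
          (card S = 2 \<longrightarrow> cvec.independent S))
    \<and> (\<forall>D\<in>{2..8}. \<forall>a\<in>vecs (D - 1).
          (\<forall>f :: complex poly. degree f = D \<longrightarrow> relation D a f) \<longrightarrow>
          a \<in> cvec.span (listed D) \<and> (D = 2 \<longrightarrow> a = 0))"
proof (intro conjI)
  show "\<forall>D\<in>{3..8}. \<forall>a\<in>listed D. \<forall>f :: complex poly. degree f = D \<longrightarrow> relation D a f"
    using listed_subset_relation_space by (auto simp: relation_space_def subset_iff)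
  show "\<forall>D\<in>{5, 7}. \<forall>S\<subseteq>listed D.
          (card S = 3 \<longrightarrow> cvec.dependent S) \<and> (card S = 2 \<longrightarrow> cvec.independent S)"
    using listed_triples_and_pairs by blast
  show "\<forall>D\<in>{2..8}. \<forall>a\<in>vecs (D - 1).
          (\<forall>f :: complex poly. degree f = D \<longrightarrow> relation D a f) \<longrightarrow>
          a \<in> cvec.span (listed D) \<and> (D = 2 \<longrightarrow> a = 0)"
  proof (intro ballI impI)
    fix D a assume "D \<in> {2..8}" "a \<in> vecs (D - 1)"
      and "\<forall>f :: complex poly. degree f = D \<longrightarrow> relation D a f"
    then show "a \<in> cvec.span (listed D) \<and> (D = 2 \<longrightarrow> a = 0)"
      using relation_space_in_span [of D a] relation_space_2 [of a]
      by (auto simp: relation_space_def)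
  qed
qed

end
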